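(* Let $(X,G,\Phi)$ be an equicontinuous Cantor minimal system and let $x\in X$. Then the discriminant group $\mathcal{D}_x$ is finite if and only if a group chain $\{G_i\}_{i\ge0}$ associated to the action with basepoint $x$ (and some partitions $\{\mathcal{P}_i\}_{i\ge0}$) can be chosen so that for all $i\ge1$ we have $$G_i\cap C_1=C_i,$$ where $C_i=\bigcap_{g\in G}gG_ig^{-1}$.
   Context: An equicontinuous Cantor minimal system $(X,G,\Phi)$ consists of a Cantor set $X$, a finitely generated infinite group $G$, and an action $\Phi\colon G\times X\to X$ by homeomorphisms (write $g\cdot x=\Phi(g)(x)$) which is minimal (every orbit is dense) and equicontinuous: for a metric $d$ on $X$, for all $\varepsilon>0$ there is $\delta>0$ such that $d(u,v)<\delta$ implies $d(g\cdot u,g\cdot v)<\varepsilon$ for all $u,v\in X$, $g\in G$. A group chain in $G$ is a properly descending chain $G=G_0\supset G_1\supset G_2\supset\cdots$ of subgroups of finite index. A group chain associated to $(X,G,\Phi)$ with basepoint $x$ and partitions $\{\mathcal{P}_i\}_{i\ge0}$ is obtained from clopen sets $X=V_0\supset V_1\supset\cdots$ with $\bigcap_iV_i=\{x\}$ such that each $\mathcal{P}_i=\{g\cdot V_i\}_{g\in G}$ is a finite partition of $X$ and $\mathrm{diam}(g\cdot V_i)<2^{-i}$ for all $g\in G$, $i\ge1$, by setting $G_i=\{g\in G\mid g\cdot V_i=V_i\}$. Such chains always exist. The discriminant group at $x$ is $\mathcal{D}_x=\varprojlim\{G_{i+1}/C_{i+1}\to G_i/C_i\}$, with bonding maps induced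 by inclusion of cosets; up to isomorphism it does not depend on the chosen group chain. *)

theory Defs
  imports "HOL-Analysis.Analysis" "HOL-Algebra.Group_Action" "HOL-Algebra.Product_Groups" "HOL-Algebra.Generated_Groups"
begin

section \<open>Equicontinuous Cantor minimal systems\<close>

definition totally_disconnected_set :: "'x::topological_space set \<Rightarrow> bool" where
  "totally_disconnected_set X \<longleftrightarrow> (\<forall>S. S \<subseteq> X \<and> connected S \<longrightarrow> (\<exists>a. S \<subseteq> {a}))"

text \<open>A Cantor set is a nonempty compact, perfect, totally disconnected metrizable space.
  Here it is a subset of a metric space, and \<^const>\<open>dist\<close> restricted to it is the chosen
  compatible metric.\<close>

definition Cantor_set :: "'x::metric_space set \<Rightarrow> bool" where
  "Cantor_set X \<longleftrightarrow>
     X \<noteq> {} \<and> compact X \<and> (\<forall>x\<in>X. x islimpt X) \<and> totally_disconnected_set X"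

definition finitely_generated_group :: "('g, 'm) monoid_scheme \<Rightarrow> bool" where
  "finitely_generated_group G \<longleftrightarrow>
     group G \<and> (\<exists>S. finite S \<and> S \<subseteq> carrier G \<and> generate G S = carrier G)"

definition equicontinuous_action ::
  "('g, 'm) monoid_scheme \<Rightarrow> 'x::metric_space set \<Rightarrow> ('g \<Rightarrow> 'x \<Rightarrow> 'x) \<Rightarrow> bool" where
  "equicontinuous_action G X \<Phi> \<longleftrightarrow>
     (\<forall>\<epsilon>>0. \<exists>\<delta>>0. \<forall>u\<in>X. \<forall>v\<in>X. \<forall>g\<in>carrier G.
        dist u v < \<delta> \<longrightarrow> dist (\<Phi> g u) (\<Phi> g v) < \<epsilon>)"

definition minimal_action ::
  "('g, 'm) monoid_scheme \<Rightarrow> 'x::metric_space set \<Rightarrow> ('g \<Rightarrow> 'x \<Rightarrow> 'x) \<Rightarrow> bool" where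
  "minimal_action G X \<Phi> \<longleftrightarrow> (\<forall>x\<in>X. X \<subseteq> closure (orbit G \<Phi> x))"

text \<open>As usual for \<^locale>\<open>group_action\<close>, each \<open>\<Phi> g\<close> is extensional outside \<open>X\<close>. The action is
  not required to be faithful.\<close>

locale equicontinuous_Cantor_minimal_system = group_action G X \<Phi>
  for G :: "('g, 'm) monoid_scheme" (structure)
    and X :: "'x::metric_space set"
    and \<Phi> :: "'g \<Rightarrow> 'x \<Rightarrow> 'x" +
  assumes Cantor: "Cantor_set X"
    and finitely_generated: "finitely_generated_group G"
    and infinite_group: "infinite (carrier G)"
    and homeo: "\<And>g. g \<in> carrier G \<Longrightarrow> homeomorphic_map (top_of_set X) (top_of_set X) (\<Phi> g)"
    and minimal: "minimal_action G X \<Phi>"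
    and equicontinuous: "equicontinuous_action G X \<Phi>"


section \<open>Group chains\<close>

definition group_chain :: "('g, 'm) monoid_scheme \<Rightarrow> (nat \<Rightarrow> 'g set) \<Rightarrow> bool" where
  "group_chain G Gs \<longleftrightarrow>
     Gs 0 = carrier G \<and>
     (\<forall>i. subgroup (Gs i) G \<and> finite (rcosets\<^bsub>G\<^esub> (Gs i)) \<and> Gs (Suc i) \<subset> Gs i)"

text \<open>The inclusions \<open>V (Suc i) \<subseteq> V i\<close> are strict whenever the stabilizers form a group
  chain.\<close>

definition associated_group_chain ::
  "('g, 'm) monoid_scheme \<Rightarrow> 'x::metric_space set \<Rightarrow> ('g \<Rightarrow> 'x \<Rightarrow> 'x) \<Rightarrow> 'x
    \<Rightarrow> (nat \<Rightarrow> 'x set set) \<Rightarrow> (nat \<Rightarrow> 'g set) \<Rightarrow> bool" where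
  "associated_group_chain G X \<Phi> x \<P> Gs \<longleftrightarrow>
     group_chain G Gs \<and>
     (\<exists>V. V 0 = X \<and>
        (\<forall>i. openin (top_of_set X) (V i) \<and> closedin (top_of_set X) (V i)) \<and>
        (\<forall>i. V (Suc i) \<subseteq> V i) \<and>
        (\<Inter>i. V i) = {x} \<and>
        (\<forall>i. \<P> i = {\<Phi> g ` V i | g. g \<in> carrier G} \<and> partition_on X (\<P> i) \<and> finite (\<P> i)) \<and>
        (\<forall>i\<ge>1. \<forall>g\<in>carrier G. diameter (\<Phi> g ` V i) < (1/2) ^ i) \<and>
        (\<forall>i. Gs i = {g \<in> carrier G. \<Phi> g ` V i = V i}))"

definition normal_core :: "('g, 'm) monoid_scheme \<Rightarrow> 'g set \<Rightarrow> 'g set" where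
  "normal_core G H = (\<Inter>g\<in>carrier G. g <#\<^bsub>G\<^esub> H #>\<^bsub>G\<^esub> inv\<^bsub>G\<^esub> g)"


section \<open>The discriminant group\<close>

definition inverse_limit :: "(nat \<Rightarrow> 'a monoid) \<Rightarrow> (nat \<Rightarrow> 'a \<Rightarrow> 'a) \<Rightarrow> (nat \<Rightarrow> 'a) monoid" where
  "inverse_limit A f = (product_group UNIV A)
     \<lparr>carrier := {s \<in> carrier (product_group UNIV A). \<forall>i. f i (s (Suc i)) = s i}\<rparr>"

text \<open>Writing \<open>C\<^sub>i\<close> for the core of \<open>G\<^sub>i\<close>, the bonding map sends a coset \<open>K\<close> of \<open>C\<^sub>i\<^sub>+\<^sub>1\<close> to the
  coset \<open>C\<^sub>i K\<close>, which is the unique coset of \<open>C\<^sub>i\<close> containing \<open>K\<close>.\<close>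

definition discriminant_group :: "('g, 'm) monoid_scheme \<Rightarrow> (nat \<Rightarrow> 'g set) \<Rightarrow> (nat \<Rightarrow> 'g set) monoid"
  where
  "discriminant_group G Gs = inverse_limit
     (\<lambda>i. G\<lparr>carrier := Gs i\<rparr> Mod normal_core G (Gs i))
     (\<lambda>i K. normal_core G (Gs i) <#>\<^bsub>G\<^esub> K)"

end

theory Submission
  imports Defs "HOL-Algebra.Zassenhaus"
begin

text \<open>Let \<open>C\<^sub>i\<close> be the core of \<open>H\<^sub>i\<close>. Since \<open>C\<^sub>i\<close> has finite index, the decreasing subgroups
  \<open>C\<^sub>i H\<^sub>n\<close> stabilize as \<open>n\<close> grows; let \<open>L\<^sub>i\<close> be their limit, whose image in \<open>H\<^sub>i / C\<^sub>i\<close> is the image of the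
  discriminant group \<open>D\<close>. If \<open>D\<close> is finite, it embeds in some \<open>H\<^sub>k / C\<^sub>k\<close>, and
  then \<open>L\<^sub>i \<inter> C\<^sub>k = C\<^sub>i\<close> for \<open>i \<ge> k\<close>, so a subsequence of \<open>L\<close> is the required chain. It is associated to
  the action because \<open>L\<^sub>i\<close> contains some \<open>H\<^sub>m\<close> and hence is the stabilizer of the clopen set \<open>L\<^sub>i \<cdot> V\<^sub>m\<close>.
  Conversely, any two associated chains interlace, and if the core condition holds for a
  chain \<open>G\<close>, then an element of \<open>D\<close> is determined by its coordinate at any \<open>p\<close> with \<open>H\<^sub>p \<subseteq> G\<^sub>1\<close>.\<close>

section \<open>Cosets and normal cores\<close>

context group
begin

lemma r_coset_eq_iff:
  assumes "subgroup H G" "a \<in> carrier G" "b \<in> carrier G"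
  shows "H #> a = H #> b \<longleftrightarrow> a \<otimes> inv b \<in> H"
  by (metis assms repr_independence rcos_self subgroup.rcos_module is_group)

lemma subset_set_mult:
  assumes "H \<subseteq> carrier G" "subgroup K G"
  shows "H \<subseteq> H <#> K" and "H \<subseteq> K <#> H"
proof -
  have "h = h \<otimes> \<one>" "h = \<one> \<otimes> h" if "h \<in> H" for h
    using that assms(1) by auto
  then show "H \<subseteq> H <#> K" "H \<subseteq> K <#> H"
    unfolding set_mult_def using subgroup.one_closed[OF assms(2)] by blast+
qed

lemma set_mult_absorb:
  assumes "subgroup K G" "subgroup N G" "K \<subseteq> N"
  shows "N <#> K = N" and "K <#> N = N"
proof -
  have "N \<subseteq> N <#> K" "N \<subseteq> K <#> N"
    using assms(1,2) by (simp_all add: subset_set_mult subgroup.subset)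
  moreover have "N <#> K \<subseteq> N <#> N" "K <#> N \<subseteq> N <#> N"
    using assms(3) by (simp_all add: mono_set_mult)
  ultimately show "N <#> K = N" "K <#> N = N"
    using subgroup_mult_id[OF assms(2)] by auto
qed

text \<open>This evaluates the bonding maps: multiplying a coset of the smaller subgroup by
  \<open>N\<close> keeps its representative.\<close>

lemma set_mult_r_coset_absorb:
  assumes "subgroup K G" "subgroup N G" "K \<subseteq> N" "a \<in> carrier G"
  shows "N <#> (K #> a) = N #> a"
  using assms by (simp add: setmult_rcos_assoc subgroup.subset set_mult_absorb)

text \<open>The map \<open>R\<close> to \<open>L <#> R\<close> sends the cosets of \<open>H\<close>
  onto those of \<open>L\<close>.\<close>

lemma finite_rcosets_mono:
  assumes "subgroup H G" "subgroup L G" "H \<subseteq> L" "finite (rcosets H)"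
  shows "finite (rcosets L)"
proof -
  have "rcosets L \<subseteq> (\<lambda>R. L <#> R) ` (rcosets H)"
    using set_mult_r_coset_absorb[OF assms(1-3)] by (force simp: RCOSETS_def)
  then show ?thesis
    using assms(4) by (meson finite_imageI finite_subset)
qed

section \<open>Normal cores and their index\<close>

lemma mem_normal_core_iff:
  assumes "H \<subseteq> carrier G"
  shows "a \<in> normal_core G H \<longleftrightarrow>
    a \<in> carrier G \<and> (\<forall>g\<in>carrier G. inv g \<otimes> a \<otimes> g \<in> H)"
proof -
  have conj: "a \<in> g <# H #> inv g \<longleftrightarrow> a \<in> carrier G \<and> inv g \<otimes> a \<otimes> g \<in> H"
    if g: "g \<in> carrier G" for g
  proof
    assume "a \<in> g <# H #> inv g"
    then obtain h where h: "h \<in> H" "a = g \<otimes> h \<otimes> inv g"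
      by (auto simp: l_coset_def r_coset_def)
    moreover have hc: "h \<in> carrier G"
      using h assms by blast
    moreover have "inv g \<otimes> a \<otimes> g = h"
      using g hc h(2) by (simp add: m_assoc) (simp add: m_assoc[symmetric])
    ultimately show "a \<in> carrier G \<and> inv g \<otimes> a \<otimes> g \<in> H"
      using g by simp
  next
    assume a: "a \<in> carrier G \<and> inv g \<otimes> a \<otimes> g \<in> H"
    then have "a = g \<otimes> (inv g \<otimes> a \<otimes> g) \<otimes> inv g"
      using g by (simp add: m_assoc) (simp add: m_assoc[symmetric])
    then show "a \<in> g <# H #> inv g"
      using a unfolding l_coset_def r_coset_def by blast
  qed
  show ?thesis
    unfolding normal_core_def using conj one_closed by auto
qed

lemma normal_core_subset:
  assumes "H \<subseteq> carrier G"
  shows "normal_core G H \<subseteq> H"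
  using assms mem_normal_core_iff[OF assms] one_closed by force

text \<open>With \<open>normal_core_subset\<close> and \<open>normal_core_normal\<close> this makes
  the core the largest normal subgroup inside \<open>H\<close>. Monotonicity and the core of
  \<open>L i\<close> follow from that property alone.\<close>

lemma normal_core_greatest:
  assumes "N \<lhd> G" "N \<subseteq> H" "H \<subseteq> carrier G"
  shows "N \<subseteq> normal_core G H"
proof
  fix a assume a: "a \<in> N"
  then have "inv g \<otimes> a \<otimes> g \<in> H" if "g \<in> carrier G" for g
    using normal.inv_op_closed1[OF assms(1) that a] assms(2) by blast
  then show "a \<in> normal_core G H"
    using a assms(2,3) by (auto simp: mem_normal_core_iff)
qed

lemma normal_core_normal:
  assumes H: "subgroup H G"
  shows "normal_core G H \<lhd> G"
proof -
  note core = mem_normal_core_iff[OF subgroup.subset[OF H]]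
  have "subgroup (normal_core G H) G"
  proof (rule subgroupI)
    show "normal_core G H \<subseteq> carrier G"
      by (auto simp: core)
    have "\<one> \<in> normal_core G H"
      using H by (auto simp: core subgroup.one_closed)
    then show "normal_core G H \<noteq> {}"
      by blast
  next
    fix a assume a: "a \<in> normal_core G H"
    show "inv a \<in> normal_core G H"
      unfolding core
    proof (intro conjI ballI)
      show "inv a \<in> carrier G" using a by (simp add: core)
      fix g assume g: "g \<in> carrier G"
      then have "inv (inv g \<otimes> a \<otimes> g) \<in> H"
        using a H by (simp add: core subgroup.m_inv_closed)
      then show "inv g \<otimes> inv a \<otimes> g \<in> H"
        using a g by (simp add: core inv_mult_group m_assoc)
    qed
  next
    fix a b assume ab: "a \<in> normal_core G H" "b \<in> normal_core G H"
    show "a \<otimes> b \<in> normal_core G H"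
      unfolding core
    proof (intro conjI ballI)
      show "a \<otimes> b \<in> carrier G" using ab by (simp add: core)
      fix g assume g: "g \<in> carrier G"
      then have "(inv g \<otimes> a \<otimes> g) \<otimes> (inv g \<otimes> b \<otimes> g) \<in> H"
        using ab H by (simp add: core subgroup.m_closed)
      moreover have "(inv g \<otimes> a \<otimes> g) \<otimes> (inv g \<otimes> b \<otimes> g) = inv g \<otimes> (a \<otimes> b) \<otimes> g"
        using ab g by (simp add: core m_assoc) (simp add: core m_assoc[symmetric])
      ultimately show "inv g \<otimes> (a \<otimes> b) \<otimes> g \<in> H" by simp
    qed
  qed
  moreover have "x \<otimes> h \<otimes> inv x \<in> normal_core G H"
    if x: "x \<in> carrier G" and h: "h \<in> normal_core G H" for x h
    unfolding core
  proof (intro conjI ballI)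
    show "x \<otimes> h \<otimes> inv x \<in> carrier G" using x h by (simp add: core)
    fix g assume g: "g \<in> carrier G"
    \<comment> \<open>Conjugating \<open>x \<otimes> h \<otimes> inv x\<close> by \<open>g\<close>
      is conjugating \<open>h\<close> by \<open>inv x \<otimes> g\<close>, which is again covered by
      membership in the core.\<close>
    have "inv (inv x \<otimes> g) \<otimes> h \<otimes> (inv x \<otimes> g) \<in> H"
      using g x h unfolding core by blast
    then show "inv g \<otimes> (x \<otimes> h \<otimes> inv x) \<otimes> g \<in> H"
      using g x h by (simp add: core m_assoc inv_mult_group)
  qed
  ultimately show ?thesis
    by (simp add: normal_inv_iff)
qed

lemma normal_core_mono:
  assumes "subgroup H G" "L \<subseteq> carrier G" "H \<subseteq> L"
  shows "normal_core G H \<subseteq> normal_core G L"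
  using assms normal_core_normal normal_core_subset normal_core_greatest
  by (meson order_trans subgroup.subset)

text \<open>The core is the kernel of the action on the finite set of right cosets.\<close>

lemma finite_rcosets_normal_core:
  assumes H: "subgroup H G" and fin: "finite (rcosets H)"
  shows "finite (rcosets (normal_core G H))"
proof -
  let ?C = "normal_core G H"
  define \<phi> where "\<phi> a = (\<lambda>R\<in>rcosets H. R #> a)" for a
  have sub: "H \<subseteq> carrier G" and C: "subgroup ?C G"
    using H normal_core_normal normal_imp_subgroup by (auto simp: subgroup.subset)
  have eq: "a \<otimes> inv b \<in> ?C \<longleftrightarrow> \<phi> a = \<phi> b" if ab: "a \<in> carrier G" "b \<in> carrier G" for a b
  proof -
    have step: "(H #> g) #> a = (H #> g) #> b \<longleftrightarrow> g \<otimes> (a \<otimes> inv b) \<otimes> inv g \<in> H"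
      if "g \<in> carrier G" for g
      using that ab by (simp add: coset_mult_assoc[OF sub] r_coset_eq_iff[OF H] inv_mult_group m_assoc)
    have "\<phi> a = \<phi> b \<longleftrightarrow> (\<forall>R\<in>rcosets H. R #> a = R #> b)"
      by (auto simp: \<phi>_def restrict_def fun_eq_iff)
    also have "\<dots> \<longleftrightarrow> (\<forall>g\<in>carrier G. (H #> g) #> a = (H #> g) #> b)"
      by (auto simp: RCOSETS_def)
    also have "\<dots> \<longleftrightarrow> (\<forall>g\<in>carrier G. g \<otimes> (a \<otimes> inv b) \<otimes> inv g \<in> H)"
      using step by auto
    also have "\<dots> \<longleftrightarrow> (\<forall>g\<in>carrier G. inv g \<otimes> (a \<otimes> inv b) \<otimes> g \<in> H)"
    proof (intro iffI ballI)
      fix g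
      assume *: "\<forall>g\<in>carrier G. g \<otimes> (a \<otimes> inv b) \<otimes> inv g \<in> H" and g: "g \<in> carrier G"
      show "inv g \<otimes> (a \<otimes> inv b) \<otimes> g \<in> H"
        using bspec[OF * inv_closed[OF g]] g by simp
    next
      fix g
      assume *: "\<forall>g\<in>carrier G. inv g \<otimes> (a \<otimes> inv b) \<otimes> g \<in> H" and g: "g \<in> carrier G"
      show "g \<otimes> (a \<otimes> inv b) \<otimes> inv g \<in> H"
        using bspec[OF * inv_closed[OF g]] g by simp
    qed
    finally show ?thesis
      using ab by (simp add: mem_normal_core_iff[OF sub])
  qed
  have "finite (\<phi> ` carrier G)"
  proof (rule finite_subset)
    have "R #> a \<in> rcosets H" if "R \<in> rcosets H" "a \<in> carrier G" for R a
      using that unfolding RCOSETS_def by (force simp: coset_mult_assoc[OF sub])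
    then show "\<phi> ` carrier G \<subseteq> (\<Pi>\<^sub>E R\<in>rcosets H. rcosets H)"
      by (auto simp: \<phi>_def)
    show "finite (\<Pi>\<^sub>E R\<in>rcosets H. rcosets H)"
      using fin by (intro finite_PiE)
  qed
  \<comment> \<open>Every coset of the core is a fibre of \<open>\<phi>\<close>, and
    \<open>\<phi>\<close> takes only finitely many values.\<close>
  moreover have "rcosets ?C \<subseteq> (\<lambda>f. {b \<in> carrier G. \<phi> b = f}) ` \<phi> ` carrier G"
  proof
    fix R assume "R \<in> rcosets ?C"
    then obtain a where a: "a \<in> carrier G" "R = ?C #> a"
      by (auto simp: RCOSETS_def)
    have "b \<in> R \<longleftrightarrow> \<phi> b = \<phi> a" if "b \<in> carrier G" for b
      using a that by (simp add: subgroup.rcos_module[OF C is_group] eq)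
    moreover have "R \<subseteq> carrier G"
      using a r_coset_subset_G[OF subgroup.subset[OF C]] by simp
    ultimately have "R = {b \<in> carrier G. \<phi> b = \<phi> a}"
      by auto
    then show "R \<in> (\<lambda>f. {b \<in> carrier G. \<phi> b = f}) ` \<phi> ` carrier G"
      using a by blast
  qed
  ultimately show ?thesis
    by (meson finite_imageI finite_subset)
qed

text \<open>Each \<open>N <#> H n\<close> is a union of cosets of \<open>N\<close>, so only finitely many sets occur.\<close>

lemma set_mult_decseq_stabilizes:
  assumes N: "N \<lhd> G" and fin: "finite (rcosets N)"
    and H: "\<And>n. H n \<subseteq> carrier G" "decseq H"
  obtains m where "\<And>n. n \<ge> m \<Longrightarrow> N <#> H n = N <#> H m"
proof -
  let ?F = "range (\<lambda>n. N <#> H n)"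
  have "?F \<subseteq> Union ` Pow (rcosets N)"
  proof clarify
    fix n
    have "N <#> H n = \<Union> ((\<lambda>h. N #> h) ` H n)"
      by (auto simp: set_mult_def r_coset_def)
    moreover have "(\<lambda>h. N #> h) ` H n \<subseteq> rcosets N"
      using H(1) by (auto simp: RCOSETS_def)
    ultimately show "N <#> H n \<in> Union ` Pow (rcosets N)"
      by blast
  qed
  then have "finite ?F"
    using fin by (meson finite_Pow_iff finite_imageI finite_subset)
  \<comment> \<open>A minimal member of the finite family is attained at some \<open>m\<close>;
    later members lie inside it and therefore equal it.\<close>
  then have "\<exists>B\<in>?F. \<forall>A\<in>?F. A \<subseteq> B \<longrightarrow> B = A"
    by (rule finite_has_minimal) simp
  then obtain m where m: "\<And>n. N <#> H n \<subseteq> N <#> H m \<Longrightarrow> N <#> H m = N <#> H n"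
    by auto
  show thesis
  proof
    fix n assume "n \<ge> m"
    then have "N <#> H n \<subseteq> N <#> H m"
      using H(2) by (intro mono_set_mult) (auto simp: decseq_def)
    then show "N <#> H n = N <#> H m"
      using m by blast
  qed
qed

end


section \<open>The discriminant group of a group chain\<close>

lemma group_chainD:
  assumes "group_chain G Gs"
  shows "Gs 0 = carrier G" "subgroup (Gs i) G" "finite (rcosets\<^bsub>G\<^esub> (Gs i))" "Gs (Suc i) \<subset> Gs i"
  using assms by (auto simp: group_chain_def)

lemma group_chain_antimono:
  assumes "group_chain G Gs" "i \<le> j"
  shows "Gs j \<subseteq> Gs i"
proof (rule lift_Suc_antimono_le[OF _ assms(2)])
  show "Gs (Suc n) \<subseteq> Gs n" for n
    using group_chainD(4)[OF assms(1)] by blast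
qed

text \<open>Strict descent is essential: if \<open>m < i\<close>, then \<open>Gs i\<close> would lie
  in \<open>Gs (Suc m)\<close>, a proper subset of \<open>Gs m\<close>.\<close>

lemma group_chain_le:
  assumes "group_chain G Gs" "Gs m \<subseteq> Gs i"
  shows "i \<le> m"
proof (rule ccontr)
  assume "\<not> i \<le> m"
  then have "Gs i \<subseteq> Gs (Suc m)"
    by (intro group_chain_antimono[OF assms(1)]) simp
  then show False
    using assms(2) group_chainD(4)[OF assms(1), of m] by blast
qed

context group
begin

lemma carrier_discriminant_group:
  "s \<in> carrier (discriminant_group G Gs) \<longleftrightarrow>
    (\<forall>i. \<exists>h\<in>Gs i. s i = normal_core G (Gs i) #> h) \<and>
    (\<forall>i. normal_core G (Gs i) <#> s (Suc i) = s i)"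
  by (auto simp: discriminant_group_def inverse_limit_def carrier_FactGroup PiE_iff image_iff)

context
  fixes Gs
  assumes chain: "group_chain G Gs"
begin

private abbreviation "C i \<equiv> normal_core G (Gs i)"

private lemmas sub = group_chainD(2)[OF chain]

private lemma C_normal: "C i \<lhd> G"
  using sub by (rule normal_core_normal)

private lemma C_subgroup: "subgroup (C i) G"
  using C_normal by (rule normal_imp_subgroup)

private lemma C_antimono: "i \<le> j \<Longrightarrow> C j \<subseteq> C i"
  using group_chain_antimono[OF chain] sub
  by (intro normal_core_mono) (auto simp: subgroup.subset)

private lemma C_subset: "C i \<subseteq> Gs i"
  using sub by (intro normal_core_subset) (auto simp: subgroup.subset)

text \<open>A representative of the coordinate at \<open>n\<close> serves all earlier coordinates,
  by downward induction along the bonding maps.\<close>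

lemma discriminant_group_representative:
  assumes s: "s \<in> carrier (discriminant_group G Gs)"
  obtains h where "h \<in> Gs n" "\<And>j. j \<le> n \<Longrightarrow> s j = normal_core G (Gs j) #> h"
proof -
  obtain h where h: "h \<in> Gs n" "s n = C n #> h"
    using s unfolding carrier_discriminant_group by blast
  then have hc: "h \<in> carrier G"
    using sub subgroup.mem_carrier by metis
  have "s j = C j #> h" if "j \<le> n" for j
    using that
  proof (induction rule: inc_induct)
    case base
    show ?case by (fact h)
  next
    case (step j)
    have "s j = C j <#> s (Suc j)"
      using s by (simp add: carrier_discriminant_group)
    also have "\<dots> = C j #> h"
      using step.IH hc C_antimono[of j "Suc j"] by (simp add: set_mult_r_coset_absorb C_subgroup)
    finally show ?case .
  qed
  then show thesis
    using h that by blast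
qed

section \<open>The subgroups \<open>L i\<close> realized by the discriminant group\<close>

private definition "m i = (LEAST m. \<forall>n\<ge>m. C i <#> Gs n = C i <#> Gs m)"

text \<open>\<open>L i\<close> is the intersection of all \<open>C i <#> Gs n\<close>. Its image in the quotient by \<open>C i\<close> is the
  image of the discriminant group.\<close>

private definition "L i = C i <#> Gs (m i)"

text \<open>Finite index of \<open>C i\<close> supplies a threshold, so the \<open>LEAST\<close>
  defining \<open>m i\<close> really has the stabilizing property.\<close>

private lemma m_stable:
  assumes "n \<ge> m i"
  shows "C i <#> Gs n = L i"
proof -
  have "decseq Gs"
    using group_chain_antimono[OF chain] by (simp add: decseq_def)
  then obtain k where "\<forall>n\<ge>k. C i <#> Gs n = C i <#> Gs k"
    using set_mult_decseq_stabilizes[OF C_normal finite_rcosets_normal_core[OF sub group_chainD(3)[OF chain]]]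
      subgroup.subset[OF sub] by metis
  then have "\<forall>n\<ge>m i. C i <#> Gs n = C i <#> Gs (m i)"
    unfolding m_def by (rule LeastI)
  then show ?thesis
    unfolding L_def using assms by blast
qed

private lemma L_subset_mult: "L i \<subseteq> C i <#> Gs n"
proof -
  have "C i <#> Gs (max n (m i)) \<subseteq> C i <#> Gs n"
    using group_chain_antimono[OF chain] by (intro mono_set_mult) auto
  then show ?thesis
    by (simp add: m_stable)
qed

private lemma L_subgroup: "subgroup (L i) G"
  unfolding L_def using C_normal sub by (rule mult_norm_subgroup)

private lemma C_subset_L: "C i \<subseteq> L i"
  unfolding L_def using C_subgroup sub by (intro subset_set_mult subgroup.subset)

private lemma L_subset: "L i \<subseteq> Gs i"
  using L_subset_mult[of i i] set_mult_absorb(2)[OF C_subgroup sub C_subset] by simp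

text \<open>Containing a member of the chain gives \<open>L i\<close> finite index, and later lets
  it be realized as a stabilizer.\<close>

private lemma Gs_subset_L: "Gs (m i) \<subseteq> L i"
  unfolding L_def using C_subgroup sub by (intro subset_set_mult subgroup.subset)

private lemma L_antimono: "i \<le> j \<Longrightarrow> L j \<subseteq> L i"
proof -
  assume "i \<le> j"
  then have "C j <#> Gs (max (m i) (m j)) \<subseteq> C i <#> Gs (max (m i) (m j))"
    using C_antimono by (intro mono_set_mult) auto
  then show ?thesis
    by (simp add: m_stable)
qed

text \<open>The core is squeezed by \<open>C i \<subseteq> L i \<subseteq> Gs i\<close>, so
  replacing \<open>Gs i\<close> by \<open>L i\<close> keeps the same core.\<close>

private lemma normal_core_L: "normal_core G (L i) = C i"
proof
  show "normal_core G (L i) \<subseteq> C i"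
    using L_subgroup subgroup.subset[OF sub] L_subset by (rule normal_core_mono)
  show "C i \<subseteq> normal_core G (L i)"
    using C_normal C_subset_L subgroup.subset[OF L_subgroup] by (rule normal_core_greatest)
qed

private lemma L_step:
  assumes "a \<in> L n"
  shows "\<exists>b\<in>L (Suc n). C n #> b = C n #> a"
proof -
  have "a \<in> C n <#> Gs (m (Suc n))"
    using assms L_subset_mult by blast
  then obtain c b where cb: "c \<in> C n" "b \<in> Gs (m (Suc n))" "a = c \<otimes> b"
    by (auto simp: set_mult_def)
  then have b: "b \<in> carrier G" and c: "c \<in> carrier G"
    using sub C_subgroup subgroup.mem_carrier by metis+
  have "C n #> a = C n #> b"
    using cb b c by (simp add: r_coset_eq_iff[OF C_subgroup] m_assoc)
  then show ?thesis
    using cb Gs_subset_L by blast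
qed

text \<open>Dependent choice iterates \<open>L_step\<close>. The representative stays equal to
  \<open>g\<close> up to index \<open>i\<close>, so that the early coordinates are cosets of
  \<open>g\<close> itself.\<close>

private lemma L_lift:
  assumes "g \<in> L i"
  obtains s where "s \<in> carrier (discriminant_group G Gs)" "\<And>j. j \<le> i \<Longrightarrow> s j = C j #> g"
proof -
  have "\<exists>f. \<forall>n. (f n \<in> L n \<and> (n \<le> i \<longrightarrow> f n = g)) \<and> C n #> f (Suc n) = C n #> f n"
  proof (rule dependent_nat_choice)
    show "\<exists>a. a \<in> L 0 \<and> (0 \<le> i \<longrightarrow> a = g)"
      using assms L_antimono[of 0 i] by auto
  next
    fix a n assume a: "a \<in> L n \<and> (n \<le> i \<longrightarrow> a = g)"
    show "\<exists>b. (b \<in> L (Suc n) \<and> (Suc n \<le> i \<longrightarrow> b = g)) \<and> C n #> b = C n #> a"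
    proof (cases "Suc n \<le> i")
      case True
      then show ?thesis
        using a assms L_antimono[of "Suc n" i] by auto
    next
      case False
      then show ?thesis
        using a L_step[of a n] by auto
    qed
  qed
  then obtain f where f: "\<And>n. f n \<in> L n" "\<And>n. n \<le> i \<Longrightarrow> f n = g"
    "\<And>n. C n #> f (Suc n) = C n #> f n"
    by blast
  have fc: "f n \<in> carrier G" for n
    using f(1) L_subgroup subgroup.mem_carrier by metis
  define s where "s n = C n #> f n" for n
  have "C n <#> s (Suc n) = s n" for n
    using set_mult_r_coset_absorb[OF C_subgroup C_subgroup C_antimono[of n "Suc n"] fc] f(3)
    by (simp add: s_def)
  moreover have "\<exists>h\<in>Gs n. s n = C n #> h" for n
    using f(1) L_subset s_def by blast
  ultimately have "s \<in> carrier (discriminant_group G Gs)"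
    by (simp add: carrier_discriminant_group)
  then show thesis
    using that f(2) s_def by blast
qed

text \<open>Finitely many elements are told apart from the identity by the coordinates up to some
  \<open>k\<close>. An element of \<open>L i \<inter> C k\<close> lifts to a thread that is trivial
  up to \<open>k\<close>, hence trivial everywhere, in particular at \<open>i\<close>.\<close>

private lemma finite_discriminant_separated:
  assumes fin: "finite (carrier (discriminant_group G Gs))"
  obtains k where "\<And>i. i \<ge> k \<Longrightarrow> L i \<inter> C k = C i"
proof -
  let ?D = "carrier (discriminant_group G Gs)"
  \<comment> \<open>Here \<open>C\<close> as a function of the index is the identity of the inverse
    limit, and \<open>d s\<close> is a coordinate witnessing that \<open>s\<close> differs from
    it.\<close>
  have ex: "\<exists>n. s n \<noteq> C n" if "s \<noteq> C" for s
    using that by auto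
  define d where "d s = (SOME n. s n \<noteq> C n)" for s
  have d: "s (d s) \<noteq> C (d s)" if "s \<noteq> C" for s
    unfolding d_def using someI_ex[OF ex[OF that]] .
  define k where "k = Max (insert 0 (d ` ?D))"
  have k: "d s \<le> k" if "s \<in> ?D" for s
    using fin that by (auto simp: k_def)
  have "L i \<inter> C k = C i" if ik: "i \<ge> k" for i
  proof
    show "C i \<subseteq> L i \<inter> C k"
      using C_subset_L C_antimono[OF ik] by blast
    show "L i \<inter> C k \<subseteq> C i"
    proof
      fix g assume g: "g \<in> L i \<inter> C k"
      then obtain s where s: "s \<in> ?D" "\<And>j. j \<le> i \<Longrightarrow> s j = C j #> g"
        using L_lift by blast
      have "g \<in> C (d s)"
        using g C_antimono[OF k[OF s(1)]] by blast
      then have "s (d s) = C (d s)"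
        using s(2)[of "d s"] k[OF s(1)] ik subgroup.rcos_const[OF C_subgroup is_group] by simp
      then have "s = C"
        using d by blast
      then have "C i #> g = C i"
        using s(2)[of i] by simp
      moreover have "g \<in> C i #> g"
        using g C_subgroup by (intro rcos_self) (auto dest: subgroup.mem_carrier)
      ultimately show "g \<in> C i"
        by simp
    qed
  qed
  then show thesis
    using that by blast
qed

lemma finite_discriminant_imp_chain:
  assumes "finite (carrier (discriminant_group G Gs))"
  obtains Ks where "group_chain G Ks" "\<And>i. Ks i \<subseteq> Gs i" "\<And>i. \<exists>n. Gs n \<subseteq> Ks i"
    "\<And>i. i \<ge> 1 \<Longrightarrow> Ks i \<inter> normal_core G (Ks 1) = normal_core G (Ks i)"
proof -
  obtain k where k: "\<And>i. i \<ge> k \<Longrightarrow> L i \<inter> C k = C i"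
    using finite_discriminant_separated[OF assms] by blast
  \<comment> \<open>The sequence \<open>L\<close> need not descend strictly. Exceeding
    \<open>m j\<close> puts the next term inside \<open>Gs (Suc (m j))\<close>, properly below
    \<open>Gs (m j) \<subseteq> L j\<close>; exceeding \<open>k\<close> makes separation available
    from index 1 on; starting at 0 keeps the first group equal to \<open>carrier G\<close>.\<close>
  define r where "r = rec_nat 0 (\<lambda>_ j. Suc (max k (max j (m j))))"
  have r0: "r 0 = 0" and rS: "r (Suc n) = Suc (max k (max (r n) (m (r n))))" for n
    by (simp_all add: r_def)
  have "r n < r (Suc n)" for n
    by (simp add: rS)
  then have r_mono: "strict_mono r"
    by (simp add: strict_mono_Suc_iff)
  have r_ge: "n \<le> r n" for n
    using r_mono by (rule strict_mono_imp_increasing)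
  have r_k: "k \<le> r n" if "n \<ge> 1" for n
    using that by (cases n) (auto simp: rS)
  define Ks where "Ks n = L (r n)" for n
  have "group_chain G Ks"
    unfolding group_chain_def
  proof (intro conjI allI)
    have "carrier G \<lhd> G"
      using normal_inv_iff subgroup_self by auto
    then have "C 0 = carrier G"
      using normal_core_greatest[of "carrier G" "Gs 0"] group_chainD(1)[OF chain] 
        subgroup.subset[OF C_subgroup[of 0]] by auto
    then show "Ks 0 = carrier G"
      using C_subset_L[of 0] subgroup.subset[OF L_subgroup, of 0] by (simp add: Ks_def r0)
    fix i
    show "subgroup (Ks i) G"
      by (simp add: Ks_def L_subgroup)
    show "finite (rcosets (Ks i))"
      unfolding Ks_def using sub L_subgroup Gs_subset_L group_chainD(3)[OF chain]
      by (rule finite_rcosets_mono)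
    have "Ks (Suc i) \<subseteq> Gs (r (Suc i))"
      by (simp add: Ks_def L_subset)
    also have "\<dots> \<subseteq> Gs (Suc (m (r i)))"
      by (rule group_chain_antimono[OF chain]) (simp add: rS)
    also have "\<dots> \<subset> Gs (m (r i))"
      by (rule group_chainD(4)[OF chain])
    also have "\<dots> \<subseteq> Ks i"
      by (simp add: Ks_def Gs_subset_L)
    finally show "Ks (Suc i) \<subset> Ks i" .
  qed
  moreover have "Ks i \<subseteq> Gs i" for i
    using L_subset[of "r i"] group_chain_antimono[OF chain r_ge[of i]] by (simp add: Ks_def)
  moreover have "\<exists>n. Gs n \<subseteq> Ks i" for i
    using Gs_subset_L Ks_def by blast
  moreover have "Ks i \<inter> normal_core G (Ks 1) = normal_core G (Ks i)" if "i \<ge> 1" for i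
  proof -
    have "Ks i \<inter> C (r 1) \<subseteq> L (r i) \<inter> C k"
      using C_antimono[OF r_k[of 1]] by (auto simp: Ks_def)
    also have "\<dots> = C (r i)"
      using k[OF r_k[OF that]] .
    finally have "Ks i \<inter> C (r 1) \<subseteq> C (r i)" .
    moreover have "C (r i) \<subseteq> Ks i \<inter> C (r 1)"
      using C_subset_L[of "r i"] C_antimono[of "r 1" "r i"] that strict_mono_less_eq[OF r_mono]
      by (auto simp: Ks_def)
    ultimately show ?thesis
      by (simp add: Ks_def normal_core_L set_eq_subset)
  qed
  ultimately show thesis
    by (rule that)
qed

text \<open>Evaluation at \<open>p\<close> is injective into the finite set of cosets of
  \<open>C p\<close>. If two threads agree there, the quotient of deep representatives lies in the
  core of \<open>Ks 1\<close> and in \<open>Ks n\<close>, hence in the core of \<open>Ks n\<close>,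
  which is inside \<open>C i\<close>.\<close>

lemma finite_discriminantI:
  assumes K: "group_chain G Ks"
    and KG: "\<And>i. \<exists>n. Ks n \<subseteq> Gs i" and GK: "\<And>i. \<exists>n. Gs n \<subseteq> Ks i"
    and int: "\<And>i. i \<ge> 1 \<Longrightarrow> Ks i \<inter> normal_core G (Ks 1) = normal_core G (Ks i)"
  shows "finite (carrier (discriminant_group G Gs))"
proof -
  let ?D = "carrier (discriminant_group G Gs)"
  obtain p where p: "Gs p \<subseteq> Ks 1"
    using GK by blast
  have Cp: "C p \<subseteq> normal_core G (Ks 1)"
    using p sub group_chainD(2)[OF K] by (intro normal_core_mono) (auto simp: subgroup.subset)
  have "inj_on (\<lambda>s. s p) ?D"
  proof (rule inj_onI)
    fix s t assume st: "s \<in> ?D" "t \<in> ?D" and eq: "s p = t p"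
    show "s = t"
    proof
      fix i
      obtain n0 where n0: "Ks n0 \<subseteq> Gs i"
        using KG by blast
      define n where "n = max 1 n0"
      have n: "n \<ge> 1" "Ks n \<subseteq> Gs i"
        using n0 group_chain_antimono[OF K, of n0 n] by (auto simp: n_def)
      obtain q0 where q0: "Gs q0 \<subseteq> Ks n"
        using GK by blast
      \<comment> \<open>Depth \<open>q\<close> forces representatives into \<open>Ks n\<close> while
        they still describe the coordinates \<open>p\<close> and \<open>i\<close>.\<close>
      define q where "q = max q0 (max p i)"
      have q: "Gs q \<subseteq> Ks n" "p \<le> q" "i \<le> q"
        using q0 group_chain_antimono[OF chain, of q0 q] by (auto simp: q_def)
      obtain a where a: "a \<in> Gs q" "\<And>j. j \<le> q \<Longrightarrow> s j = C j #> a"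
        using discriminant_group_representative[OF st(1)] by blast
      obtain b where b: "b \<in> Gs q" "\<And>j. j \<le> q \<Longrightarrow> t j = C j #> b"
        using discriminant_group_representative[OF st(2)] by blast
      have ab: "a \<in> carrier G" "b \<in> carrier G"
        using a b sub subgroup.mem_carrier by metis+
      have "a \<otimes> inv b \<in> C p"
        using eq a(2) b(2) q(2) ab by (simp add: r_coset_eq_iff[OF C_subgroup])
      moreover have "a \<otimes> inv b \<in> Gs q"
        using a b sub by (meson subgroup.m_closed subgroup.m_inv_closed)
      ultimately have "a \<otimes> inv b \<in> normal_core G (Ks n)"
        using int[OF n(1)] Cp q(1) by blast
      moreover have "normal_core G (Ks n) \<subseteq> C i"
        using n(2) sub group_chainD(2)[OF K] by (intro normal_core_mono) (auto simp: subgroup.subset)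
      ultimately have "a \<otimes> inv b \<in> C i"
        by blast
      then show "s i = t i"
        using a(2) b(2) q(3) ab by (simp add: r_coset_eq_iff[OF C_subgroup])
    qed
  qed
  moreover have "(\<lambda>s. s p) ` ?D \<subseteq> rcosets (C p)"
  proof clarify
    fix s assume "s \<in> ?D"
    then obtain h where "h \<in> Gs p" "s p = C p #> h"
      unfolding carrier_discriminant_group by blast
    then show "s p \<in> rcosets (C p)"
      using sub subgroup.mem_carrier C_subgroup subgroup.subset by (metis rcosetsI)
  qed
  moreover have "finite (rcosets (C p))"
    using finite_rcosets_normal_core[OF sub group_chainD(3)[OF chain]] .
  ultimately show ?thesis
    by (meson finite_imageD finite_subset)
qed

end

end

section \<open>Group chains associated to the action\<close>

text \<open>The body of the existential in \<open>associated_group_chain\<close> with the witness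
  \<open>V\<close> exposed, so that its clauses can be cited one by one.\<close>

definition block_sequence ::
  "('g, 'm) monoid_scheme \<Rightarrow> 'x::metric_space set \<Rightarrow> ('g \<Rightarrow> 'x \<Rightarrow> 'x) \<Rightarrow> 'x
    \<Rightarrow> (nat \<Rightarrow> 'x set set) \<Rightarrow> (nat \<Rightarrow> 'g set) \<Rightarrow> (nat \<Rightarrow> 'x set) \<Rightarrow> bool" where
  "block_sequence G X \<Phi> x \<P> Gs V \<longleftrightarrow>
     V 0 = X \<and>
     (\<forall>i. openin (top_of_set X) (V i) \<and> closedin (top_of_set X) (V i)) \<and>
     (\<forall>i. V (Suc i) \<subseteq> V i) \<and>
     (\<Inter>i. V i) = {x} \<and>
     (\<forall>i. \<P> i = {\<Phi> g ` V i | g. g \<in> carrier G} \<and> partition_on X (\<P> i) \<and> finite (\<P> i)) \<and>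
     (\<forall>i\<ge>1. \<forall>g\<in>carrier G. diameter (\<Phi> g ` V i) < (1/2) ^ i) \<and>
     (\<forall>i. Gs i = {g \<in> carrier G. \<Phi> g ` V i = V i})"

lemma associated_group_chain_iff:
  "associated_group_chain G X \<Phi> x \<P> Gs \<longleftrightarrow>
    group_chain G Gs \<and> (\<exists>V. block_sequence G X \<Phi> x \<P> Gs V)"
  unfolding associated_group_chain_def block_sequence_def by (rule refl)

lemma block_sequenceD:
  assumes "block_sequence G X \<Phi> x \<P> Gs V"
  shows "V 0 = X" "openin (top_of_set X) (V i)" "closedin (top_of_set X) (V i)"
    "V (Suc i) \<subseteq> V i" "(\<Inter>i. V i) = {x}"
    "\<P> i = {\<Phi> g ` V i | g. g \<in> carrier G}" "partition_on X (\<P> i)" "finite (\<P> i)"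
    "1 \<le> i \<Longrightarrow> g \<in> carrier G \<Longrightarrow> diameter (\<Phi> g ` V i) < (1/2) ^ i"
    "Gs i = {g \<in> carrier G. \<Phi> g ` V i = V i}"
  using assms unfolding block_sequence_def by metis+

section \<open>Blocks and their stabilizers\<close>

context group_action
begin

lemma group: "group G"
  using group_hom by (rule group_hom.axioms)

lemma image_one: "A \<subseteq> E \<Longrightarrow> \<phi> \<one> ` A = A"
  unfolding id_eq_one[symmetric] by force

lemma image_mult:
  assumes "A \<subseteq> E" "g \<in> carrier G" "h \<in> carrier G"
  shows "\<phi> (g \<otimes> h) ` A = \<phi> g ` \<phi> h ` A"
  unfolding image_image using assms by (intro image_cong) (auto intro: composition_rule)

lemma image_eq_iff_stabilizer:
  assumes A: "A \<subseteq> E" and gh: "g \<in> carrier G" "h \<in> carrier G"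
  shows "\<phi> g ` A = \<phi> h ` A \<longleftrightarrow> \<phi> (inv h \<otimes> g) ` A = A"
proof -
  interpret group G by (rule group)
  have "\<phi> (inv h) ` \<phi> h ` A = A"
    using A gh by (simp flip: image_mult add: image_one)
  moreover have "\<phi> h ` \<phi> (inv h \<otimes> g) ` A = \<phi> g ` A"
    using A gh by (simp flip: image_mult m_assoc)
  moreover have "\<phi> (inv h \<otimes> g) ` A = \<phi> (inv h) ` \<phi> g ` A"
    using A gh by (simp add: image_mult)
  ultimately show ?thesis
    by metis
qed

text \<open>Subgroups above the stabilizer of a block correspond to coarser block systems.\<close>

lemma translates_of_union:
  fixes V H L
  defines "W \<equiv> \<Union>l\<in>L. \<phi> l ` V"
  assumes V: "V \<subseteq> E" and part: "partition_on E {\<phi> g ` V | g. g \<in> carrier G}"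
    and H: "H = {g \<in> carrier G. \<phi> g ` V = V}"
    and L: "subgroup L G" "H \<subseteq> L"
  shows "L = {g \<in> carrier G. \<phi> g ` W = W}"
    and "partition_on E {\<phi> g ` W | g. g \<in> carrier G}"
    and "\<And>g. g \<in> carrier G \<Longrightarrow> \<phi> g ` W = (\<Union>l\<in>L. \<phi> (g \<otimes> l) ` V)"
    and "V \<subseteq> W" "W \<subseteq> E"
proof -
  interpret group G by (rule group)
  interpret L: subgroup L G by (rule L(1))
  have VW: "V \<subseteq> W"
    using L.one_closed image_one[OF V] unfolding W_def by blast
  have WE: "W \<subseteq> E"
    using V surj_prop L.mem_carrier unfolding W_def by blast
  \<comment> \<open>Partitions have no empty blocks, so \<open>W\<close> is nonempty; this later
    lets \<open>block\<close> be applied with \<open>h = \<one>\<close> to an element stabilizing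
    \<open>W\<close>.\<close>
  have "\<phi> \<one> ` V \<noteq> {}"
    using part unfolding partition_on_def by blast
  then have W_ne: "W \<noteq> {}"
    using VW by auto
  have W: "\<phi> g ` W = (\<Union>l\<in>L. \<phi> (g \<otimes> l) ` V)" if "g \<in> carrier G" for g
    using that by (simp add: W_def image_UN image_mult[OF V] L.mem_carrier)
  have L_le: "\<phi> l ` W \<subseteq> W" if l: "l \<in> L" for l
  proof -
    have "\<phi> l ` W = (\<Union>l'\<in>L. \<phi> (l \<otimes> l') ` V)"
      using l by (intro W L.mem_carrier)
    also have "\<dots> \<subseteq> W"
      unfolding W_def using L.m_closed[OF l] by blast
    finally show ?thesis .
  qed
  have L_eq: "\<phi> l ` W = W" if l: "l \<in> L" for l
  proof
    show "\<phi> l ` W \<subseteq> W" using l by (rule L_le)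
    have "W = \<phi> l ` \<phi> (inv l) ` W"
      using l WE by (simp flip: image_mult add: image_one L.mem_carrier)
    also have "\<dots> \<subseteq> \<phi> l ` W"
      using l by (intro image_mono L_le) simp
    finally show "W \<subseteq> \<phi> l ` W" .
  qed
  \<comment> \<open>Meeting translates of \<open>W\<close> contain translates of \<open>V\<close>
    with a common point. These coincide, which gives an element of \<open>H \<subseteq> L\<close>;
    cancelling \<open>l\<close> and \<open>l'\<close> stays inside \<open>L\<close>.\<close>
  have block: "inv h \<otimes> g \<in> L"
    if gh: "g \<in> carrier G" "h \<in> carrier G" and meet: "\<phi> g ` W \<inter> \<phi> h ` W \<noteq> {}" for g h
  proof -
    obtain y where y: "y \<in> \<phi> g ` W" "y \<in> \<phi> h ` W"
      using meet by blast
    obtain l where l: "l \<in> L" "y \<in> \<phi> (g \<otimes> l) ` V"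
      using y(1) unfolding W[OF gh(1)] by blast
    obtain l' where l': "l' \<in> L" "y \<in> \<phi> (h \<otimes> l') ` V"
      using y(2) unfolding W[OF gh(2)] by blast
    have lc: "l \<in> carrier G" "l' \<in> carrier G"
      using l l' by (auto intro: L.mem_carrier)
    have "disjoint {\<phi> g ` V | g. g \<in> carrier G}"
      using part by (simp add: partition_on_def)
    moreover have "g \<otimes> l \<in> carrier G" "h \<otimes> l' \<in> carrier G"
      using gh lc by simp_all
    ultimately have "\<phi> (g \<otimes> l) ` V = \<phi> (h \<otimes> l') ` V"
      using l(2) l'(2) by (blast dest: disjointD)
    then have "inv (h \<otimes> l') \<otimes> (g \<otimes> l) \<in> L"
      using L(2) gh lc V by (auto simp: H image_eq_iff_stabilizer)
    then have "l' \<otimes> (inv (h \<otimes> l') \<otimes> (g \<otimes> l)) \<otimes> inv l \<in> L"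
      using l(1) l'(1) by simp
    also have "l' \<otimes> (inv (h \<otimes> l') \<otimes> (g \<otimes> l)) \<otimes> inv l = inv h \<otimes> g"
      using gh lc by (simp add: inv_mult_group m_assoc) (simp flip: m_assoc)
    finally show ?thesis .
  qed
  have "g \<in> L" if "g \<in> carrier G" "\<phi> g ` W = W" for g
    using block[of g \<one>] that W_ne image_one[OF WE] by simp
  then show "L = {g \<in> carrier G. \<phi> g ` W = W}"
    using L_eq L.mem_carrier by blast
  show "partition_on E {\<phi> g ` W | g. g \<in> carrier G}"
  proof (rule partition_onI)
    have "E = (\<Union>g\<in>carrier G. \<phi> g ` V)"
      using part by (auto simp: partition_on_def)
    also have "\<dots> \<subseteq> (\<Union>g\<in>carrier G. \<phi> g ` W)"
      using VW by (intro UN_mono image_mono) auto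
    finally have "E \<subseteq> \<Union>{\<phi> g ` W | g. g \<in> carrier G}"
      by (simp add: Setcompr_eq_image)
    moreover have "\<phi> g ` W \<subseteq> E" if "g \<in> carrier G" for g
      using image_mono[OF WE, of "\<phi> g"] surj_prop[OF that] by simp
    ultimately show "\<Union>{\<phi> g ` W | g. g \<in> carrier G} = E"
      by (intro subset_antisym Union_least) auto
  next
    fix A B assume "A \<in> {\<phi> g ` W | g. g \<in> carrier G}" "B \<in> {\<phi> g ` W | g. g \<in> carrier G}" "A \<noteq> B"
    then obtain g h where gh: "g \<in> carrier G" "h \<in> carrier G" "A = \<phi> g ` W" "B = \<phi> h ` W"
      by blast
    have "\<phi> g ` W = \<phi> h ` W" if "inv h \<otimes> g \<in> L"
      using image_eq_iff_stabilizer[OF WE gh(1,2)] L_eq[OF that] by simp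
    then show "disjnt A B"
      using block[OF gh(1,2)] gh(3,4) \<open>A \<noteq> B\<close> unfolding disjnt_def by blast
  next
    show "{} \<notin> {\<phi> g ` W | g. g \<in> carrier G}"
      using W_ne by blast
  qed
  show "\<phi> g ` W = (\<Union>l\<in>L. \<phi> (g \<otimes> l) ` V)" if "g \<in> carrier G" for g
    using that by (rule W)
  show "V \<subseteq> W" "W \<subseteq> E"
    by (rule VW, rule WE)
qed

end

section \<open>Comparing and refining associated chains\<close>

context equicontinuous_Cantor_minimal_system
begin

lemma bounded_X: "bounded X"
  using Cantor compact_imp_bounded by (auto simp: Cantor_set_def)

lemma clopen_translate:
  assumes "g \<in> carrier G" "openin (top_of_set X) A" "closedin (top_of_set X) A"
  shows "openin (top_of_set X) (\<Phi> g ` A)" "closedin (top_of_set X) (\<Phi> g ` A)"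
  using homeomorphic_imp_open_map[OF homeo[OF assms(1)]] homeomorphic_imp_closed_map[OF homeo[OF assms(1)]]
    assms(2,3) by (auto simp: open_map_def closed_map_def)

text \<open>Blocks around \<open>x\<close> of small diameter fit inside the open set
  \<open>V i\<close>. An element stabilizing such a block moves \<open>x\<close> within
  \<open>V i\<close>, so it must fix the block \<open>V i\<close>.\<close>

lemma associated_group_chain_cofinal:
  assumes H: "associated_group_chain G X \<Phi> x \<Q> Hs" and K: "associated_group_chain G X \<Phi> x \<P> Ks"
  shows "\<exists>n. Ks n \<subseteq> Hs i"
proof -
  interpret group G by (rule group)
  obtain V where "block_sequence G X \<Phi> x \<Q> Hs V"
    using H by (auto simp: associated_group_chain_iff)
  note V = block_sequenceD[OF this]
  obtain W where "block_sequence G X \<Phi> x \<P> Ks W"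
    using K by (auto simp: associated_group_chain_iff)
  note W = block_sequenceD[OF this]
  have xV: "x \<in> V i" and xW: "x \<in> W n" for n
    using V(5) W(5) by blast+
  have WX: "W n \<subseteq> X" for n
    using W(2) openin_imp_subset by blast
  have VX: "V i \<subseteq> X"
    using V(2) openin_imp_subset by blast
  obtain e where e: "e > 0" "ball x e \<inter> X \<subseteq> V i"
    using V(2)[of i] xV unfolding openin_contains_ball by blast
  obtain n0 where "(1/2) ^ n0 < e"
    using real_arch_pow_inv[OF e(1), of "1/2"] by auto
  \<comment> \<open>Passing to the successor guarantees \<open>n \<ge> 1\<close>, the range where
    the diameter bound is assumed.\<close>
  moreover have "(1/2) ^ Suc n0 \<le> ((1/2) ^ n0 :: real)"
    by simp
  ultimately have "(1/2) ^ Suc n0 < e"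
    by (rule le_less_trans[rotated])
  then obtain n where n: "n \<ge> 1" "(1/2) ^ n < e"
    using that[of "Suc n0"] by simp
  have "W n \<subseteq> V i"
  proof
    fix y assume y: "y \<in> W n"
    have "dist x y \<le> diameter (W n)"
      using bounded_subset[OF bounded_X WX] xW y by (rule diameter_bounded_bound)
    also have "\<dots> < (1/2) ^ n"
      using W(9)[OF n(1) one_closed] image_one[OF WX] by simp
    finally have "y \<in> ball x e \<inter> X"
      using n(2) subsetD[OF WX y] by simp
    then show "y \<in> V i"
      using e(2) by blast
  qed
  have "g \<in> Hs i" if g: "g \<in> Ks n" for g
  proof -
    have gc: "g \<in> carrier G" and "\<Phi> g ` W n = W n"
      using g by (auto simp: W(10))
    then have "\<Phi> g x \<in> \<Phi> g ` V i \<inter> V i"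
      using xW[of n] xV \<open>W n \<subseteq> V i\<close> by blast
    moreover have "V i \<in> \<Q> i"
      unfolding V(6) using image_one[OF VX] one_closed by blast
    moreover have "\<Phi> g ` V i \<in> \<Q> i"
      unfolding V(6) using gc by blast
    ultimately have "\<Phi> g ` V i = V i"
      using partition_onD2[OF V(7)[of i]] by (blast dest: disjointD)
    then show ?thesis
      using gc by (simp add: V(10))
  qed
  then show ?thesis
    by blast
qed

text \<open>\<open>Ks i\<close> becomes the stabilizer of the union of its translates of
  \<open>V (m i)\<close>, because it contains \<open>Hs (m i)\<close>. The inclusion in
  \<open>Hs i\<close> keeps this union inside \<open>V i\<close>, so diameters and the intersection
  are inherited.\<close>

lemma associated_group_chain_refine:
  assumes H: "associated_group_chain G X \<Phi> x \<Q> Hs" and K: "group_chain G Ks"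
    and KH: "\<And>i. Ks i \<subseteq> Hs i" and HK: "\<And>i. \<exists>n. Hs n \<subseteq> Ks i"
  shows "\<exists>\<P>. associated_group_chain G X \<Phi> x \<P> Ks"
proof -
  interpret group G by (rule group)
  obtain V where "block_sequence G X \<Phi> x \<Q> Hs V" and chain: "group_chain G Hs"
    using H by (auto simp: associated_group_chain_iff)
  note V = chain block_sequenceD[OF this(1)]
  have VX: "V i \<subseteq> X" for i
    using V(3) openin_imp_subset by blast
  have V_antimono: "V j \<subseteq> V i" if "i \<le> j" for i j
    by (rule lift_Suc_antimono_le[of V, OF V(5) that])
  \<comment> \<open>Choosing the least index makes \<open>m\<close> monotone, hence \<open>W\<close>
    decreasing, and gives \<open>m 0 = 0\<close>, hence \<open>W 0 = X\<close>.\<close>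
  define m where "m i = (LEAST n. Hs n \<subseteq> Ks i)" for i
  have mK: "Hs (m i) \<subseteq> Ks i" for i
    unfolding m_def using HK by (rule LeastI_ex)
  have m_mono: "m i \<le> m (Suc i)" for i
    unfolding m_def[of i] using mK[of "Suc i"] group_chainD(4)[OF K, of i] by (intro Least_le) blast
  have m_ge: "i \<le> m i" for i
    using V(1) subset_trans[OF mK KH] by (rule group_chain_le)
  have "m 0 \<le> 0"
    unfolding m_def using group_chainD(1)[OF K] group_chainD(1)[OF V(1)] by (intro Least_le) simp
  then have m0: "m 0 = 0"
    by simp
  define W where "W i = (\<Union>l\<in>Ks i. \<Phi> l ` V (m i))" for i
  define P where "P i = {\<Phi> g ` W i | g. g \<in> carrier G}" for i
  have Kc: "l \<in> carrier G" if "l \<in> Ks i" for l i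
    using that group_chainD(2)[OF K] subgroup.mem_carrier by metis
  have part: "partition_on X {\<Phi> g ` V i | g. g \<in> carrier G}" for i
    using V(7,8) by metis
  note W = translates_of_union[OF VX part V(11) group_chainD(2)[OF K] mK, folded W_def]
  have WV: "W i \<subseteq> V i" for i
  proof -
    have "\<Phi> l ` V (m i) \<subseteq> V i" if "l \<in> Ks i" for l
    proof -
      have "l \<in> Hs i"
        using that KH by blast
      then have "\<Phi> l ` V i = V i"
        by (simp add: V(11))
      then show ?thesis
        using V_antimono[OF m_ge[of i]] by blast
    qed
    then show ?thesis
      unfolding W_def by blast
  qed
  have translate_mem: "\<Phi> l ` V (m i) \<in> \<Q> (m i)" if "l \<in> carrier G" for l i
    using that by (auto simp: V(7))
  have "W 0 = X"
    using W(5)[of 0] W(4)[of 0, unfolded m0 V(2)] by (rule subset_antisym)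
  moreover have "openin (top_of_set X) (W i)" for i
    unfolding W_def
  proof (rule openin_Union)
    show "openin (top_of_set X) A" if "A \<in> (\<lambda>l. \<Phi> l ` V (m i)) ` Ks i" for A
      using that Kc[of _ i] clopen_translate(1)[OF _ V(3,4)[of "m i"]] by blast
  qed
  moreover have "closedin (top_of_set X) (W i)" for i
    unfolding W_def
  proof (rule closedin_Union)
    \<comment> \<open>\<open>Ks i\<close> may be infinite, but the distinct translates all belong to
      the finite partition \<open>\<Q> (m i)\<close>.\<close>
    show "finite ((\<lambda>l. \<Phi> l ` V (m i)) ` Ks i)"
      using translate_mem[of _ i] Kc[of _ i] by (intro finite_subset[OF _ V(9)[of "m i"]]) blast
    show "closedin (top_of_set X) A" if "A \<in> (\<lambda>l. \<Phi> l ` V (m i)) ` Ks i" for A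
      using that Kc[of _ i] clopen_translate(2)[OF _ V(3,4)[of "m i"]] by blast
  qed
  moreover have "W (Suc i) \<subseteq> W i" for i
    unfolding W_def using group_chainD(4)[OF K, of i] V_antimono[OF m_mono[of i]] by blast
  moreover have "(\<Inter>i. W i) = {x}"
  proof
    show "(\<Inter>i. W i) \<subseteq> {x}"
      using V(6) WV by blast
    show "{x} \<subseteq> (\<Inter>i. W i)"
      using V(6) W(4) by blast
  qed
  moreover have "partition_on X (P i)" for i
    unfolding P_def by (rule W(2))
  moreover have "finite (P i)" for i
  proof (rule finite_subset)
    \<comment> \<open>Each translate of \<open>W i\<close> is a union of members of the finite
      partition \<open>\<Q> (m i)\<close>.\<close>
    show "P i \<subseteq> Union ` Pow (\<Q> (m i))"
    proof
      fix B assume "B \<in> P i"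
      then obtain g where g: "g \<in> carrier G" "B = \<Phi> g ` W i"
        by (auto simp: P_def)
      then have "B = \<Union>((\<lambda>l. \<Phi> (g \<otimes> l) ` V (m i)) ` Ks i)"
        by (simp add: W(3))
      moreover have "(\<lambda>l. \<Phi> (g \<otimes> l) ` V (m i)) ` Ks i \<subseteq> \<Q> (m i)"
        using translate_mem[of _ i] Kc[of _ i] g(1) by blast
      ultimately show "B \<in> Union ` Pow (\<Q> (m i))"
        by blast
    qed
    show "finite (Union ` Pow (\<Q> (m i)))"
      using V(9) by simp
  qed
  moreover have "diameter (\<Phi> g ` W i) < (1/2) ^ i" if "1 \<le> i" "g \<in> carrier G" for i g
  proof -
    have "\<Phi> g ` V i \<subseteq> X"
      using VX surj_prop[OF that(2)] by blast
    then have "diameter (\<Phi> g ` W i) \<le> diameter (\<Phi> g ` V i)"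
      using WV by (intro diameter_subset image_mono bounded_subset[OF bounded_X])
    then show ?thesis
      using V(10)[OF that] by simp
  qed
  moreover have "Ks i = {g \<in> carrier G. \<Phi> g ` W i = W i}" for i
    by (rule W(1))
  ultimately have "block_sequence G X \<Phi> x P Ks W"
    unfolding block_sequence_def P_def by simp
  then show ?thesis
    using K unfolding associated_group_chain_iff by blast
qed

end

text \<open>The discriminant group is formed from an arbitrary associated chain \<open>Hs\<close>.
  The chain on the right may differ from it, so the converse compares the two by cofinality in both
  directions.\<close>

theorem theorem6p1:
  fixes G :: "('g, 'm) monoid_scheme"
    and X :: "'x::metric_space set"
    and \<Phi> :: "'g \<Rightarrow> 'x \<Rightarrow> 'x"
    and x :: 'x
    and \<Q> :: "nat \<Rightarrow> 'x set set"
    and Hs :: "nat \<Rightarrow> 'g set"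
  assumes system: "equicontinuous_Cantor_minimal_system G X \<Phi>"
    and basepoint: "x \<in> X"
    and chain: "associated_group_chain G X \<Phi> x \<Q> Hs"
  shows "finite (carrier (discriminant_group G Hs)) \<longleftrightarrow>
    (\<exists>Gs \<P>. associated_group_chain G X \<Phi> x \<P> Gs \<and>
      (\<forall>i\<ge>1. Gs i \<inter> normal_core G (Gs 1) = normal_core G (Gs i)))"
proof -
  interpret equicontinuous_Cantor_minimal_system G X \<Phi> by (rule system)
  interpret group G by (rule group)
  have group_chain: "group_chain G Ks" if "associated_group_chain G X \<Phi> x \<P> Ks" for \<P> Ks
    using that by (simp add: associated_group_chain_def)
  show ?thesis
  proof
    assume "finite (carrier (discriminant_group G Hs))"
    then obtain Ks where Ks: "group_chain G Ks" "\<And>i. Ks i \<subseteq> Hs i" "\<And>i. \<exists>n. Hs n \<subseteq> Ks i"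
      "\<And>i. i \<ge> 1 \<Longrightarrow> Ks i \<inter> normal_core G (Ks 1) = normal_core G (Ks i)"
      using finite_discriminant_imp_chain[OF group_chain[OF chain]] by blast
    then show "\<exists>Gs \<P>. associated_group_chain G X \<Phi> x \<P> Gs \<and>
        (\<forall>i\<ge>1. Gs i \<inter> normal_core G (Gs 1) = normal_core G (Gs i))"
      using associated_group_chain_refine[OF chain Ks(1-3)] by blast
  next
    assume "\<exists>Gs \<P>. associated_group_chain G X \<Phi> x \<P> Gs \<and>
        (\<forall>i\<ge>1. Gs i \<inter> normal_core G (Gs 1) = normal_core G (Gs i))"
    then obtain Gs \<P> where Gs: "associated_group_chain G X \<Phi> x \<P> Gs"
      "\<And>i. i \<ge> 1 \<Longrightarrow> Gs i \<inter> normal_core G (Gs 1) = normal_core G (Gs i)"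
      by blast
    show "finite (carrier (discriminant_group G Hs))"
      using group_chain[OF chain] group_chain[OF Gs(1)]
        associated_group_chain_cofinal[OF chain Gs(1)] associated_group_chain_cofinal[OF Gs(1) chain] Gs(2)
      by (rule finite_discriminantI)
  qed
qed

end
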